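(* Let $N\ge 0$ be an integer and let $\{b_n\}_{n\ge 0}$ be a sequence of nonzero complex numbers such that $b_i\neq b_j$ for all $0\le i\neq j\le N$, and such that none of the denominators below vanish. Then for any $f(x)\in \mathcal{L}_{N}(P(x),Q(x))$ and all $x\ne 0$, $$\frac{f(x)}{x^N}=\sum_{k=0}^{N}\frac{f(b_k)}{b_k^N}\prod_{i=0,\,i\neq k}^{N}\frac{\theta(b_ix,b_i/x;p)}{\theta(b_ib_k,b_i/b_k;p)}.$$
   Context: Let $p\in\mathbb{C}$, $|p|<1$. Write $(x;p)_\infty=\prod_{n=0}^\infty(1-xp^n)$. The modified Jacobi theta function is $\theta(x;p)=\prod_{n=0}^{\infty}(1-xp^n)(1-p^{n+1}/x)$ for $x\ne 0$, and $\theta(x_1,\dots,x_m;p)=\prod_{k=1}^m\theta(x_k;p)$. Empty products equal $1$. Define $P(x)=\theta(-x^2;p^2)\,(-p;p)_\infty$ and $Q(x)=x\,\theta(-px^2;p^2)\,(-p;p)_\infty$ for $x\ne0$, where $\theta(-px^2;p^2)=\prod_{n\ge 0}(1+p^{2n+1}x^2)(1+p^{2n+1}/x^2)$. For an integer $N\ge 0$, $\mathcal{L}_N(P(x),Q(x))$ denotes the set of all functions of the form $\sum_{k=0}^{N}\lambda_kP(x)^kQ(x)^{N-k}$ with complex coefficients $\lambda_k$ independent of $x$ ("elliptic Askey-Wilson polynomials of degree $N$"). *)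

theory Defs
  imports "HOL-Analysis.Analysis"
begin

definition qpoch :: "complex \<Rightarrow> complex \<Rightarrow> complex" where
  "qpoch x p = (\<Prod>n. 1 - x * p ^ n)"

definition theta :: "complex \<Rightarrow> complex \<Rightarrow> complex" where
  "theta x p = (\<Prod>n. (1 - x * p ^ n) * (1 - p ^ (n + 1) / x))"

definition thetas :: "complex list \<Rightarrow> complex \<Rightarrow> complex" where
  "thetas xs p = (\<Prod>x\<leftarrow>xs. theta x p)"

definition P :: "complex \<Rightarrow> complex \<Rightarrow> complex" where
  "P p x = theta (- (x ^ 2)) (p ^ 2) * qpoch (- p) p"

text \<open>For \<open>p = 0\<close> the first argument of \<open>theta\<close> in the next definition is zero. The lemma
  \<open>theta_Q_factor\<close> below shows that the factor still agrees with the product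
  \<open>\<Prod>n. (1 + p ^ (2 * n + 1) * x ^ 2) * (1 + p ^ (2 * n + 1) / x ^ 2)\<close>, which is its
  intended meaning.\<close>

definition Q :: "complex \<Rightarrow> complex \<Rightarrow> complex" where
  "Q p x = x * theta (- p * x ^ 2) (p ^ 2) * qpoch (- p) p"

lemma theta_Q_factor:
  assumes "x \<noteq> 0"
  shows "theta (- p * x ^ 2) (p ^ 2) =
    (\<Prod>n. (1 + p ^ (2 * n + 1) * x ^ 2) * (1 + p ^ (2 * n + 1) / x ^ 2))"
proof -
  have "(1 - (- p * x ^ 2) * (p ^ 2) ^ n) * (1 - (p ^ 2) ^ (n + 1) / (- p * x ^ 2)) =
      (1 + p ^ (2 * n + 1) * x ^ 2) * (1 + p ^ (2 * n + 1) / x ^ 2)" for n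
    using assms by (cases "p = 0") (simp_all add: field_simps power2_eq_square power_mult power_mult_distrib)
  then show ?thesis
    by (simp only: theta_def)
qed

text \<open>The functions live on \<open>x \<noteq> 0\<close>, so their value at \<open>0\<close> is left unconstrained.\<close>

definition elliptic_AW :: "complex \<Rightarrow> nat \<Rightarrow> (complex \<Rightarrow> complex) set" where
  "elliptic_AW p N =
    {f. \<exists>c :: nat \<Rightarrow> complex. \<forall>x. x \<noteq> 0 \<longrightarrow> f x = (\<Sum>k=0..N. c k * P p x ^ k * Q p x ^ (N - k))}"

end

theory Submission
  imports Defs
begin

text \<open>
The theorem is Lagrange interpolation in disguise. A function in the span of the
\<open>P\<^sup>k Q\<^sup>N\<^sup>-\<^sup>k\<close> is a binary form of degree \<open>N\<close> evaluated at \<open>(P x, Q x)\<close>, and a binary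
form is recovered from its values at \<open>N + 1\<close> pairwise non-proportional vectors \<open>(u\<^sub>i, v\<^sub>i)\<close>:
the \<open>k\<close>-th basis form is the product of the normalised determinants \<open>u\<^sub>i t - v\<^sub>i s\<close> over
\<open>i \<noteq> k\<close> (\<open>homogeneous_lagrange\<close>). For the points \<open>(P (b i), Q (b i))\<close> these determinants factor
completely, by the addition formula (\<open>theta_addition_formula\<close>)

\<open>P(y) Q(x) - P(x) Q(y) = x \<theta>(y x, y / x; p)\<close>,

so the hypothesis on the denominators says exactly that the interpolation points are
non-proportional, and the powers of \<open>x\<close> and \<open>b k\<close> in the formula come from the factor \<open>x\<close>.

The addition formula is proved with the Jacobi triple product
(\<open>jacobi_triple_product\<close>), which expands \<open>(p; p)\<^sub>\<infinity> \<theta>(z; p)\<close> as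
\<open>\<Sum>j\<in>\<int>. (- 1)\<^sup>j p\<^bsup>j(j - 1)/2\<^esup> z\<^sup>j\<close>. In the product of the series for \<open>z = y x\<close> and
\<open>z = y / x\<close>, with summation indices \<open>m\<close> and \<open>n\<close>, passing to half the sum and half the difference
of \<open>m\<close> and \<open>n\<close> separates the exponent. These are integers when \<open>m + n\<close> is even, and become
integers after a shift of \<open>n\<close> by one when it is odd, so each parity class contributes a product of two
theta series of nome \<open>p\<^sup>2\<close>. After multiplication by \<open>x\<close>, the even class gives \<open>P(y) Q(x)\<close> and the odd
one \<open>- P(x) Q(y)\<close>. The series need \<open>p \<noteq> 0\<close>; for \<open>p = 0\<close> the formula is a polynomial identity.
The constants match because \<open>(p\<^sup>2; p\<^sup>2)\<^sub>\<infinity> = (p; p)\<^sub>\<infinity> (- p; p)\<^sub>\<infinity>\<close> (\<open>qpoch_square\<close>).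

The triple product itself is the limit of the finite identity \<open>finite_triple_product\<close>, in which the
coefficients are central \<open>q\<close>-binomials. Dominated convergence applies because these are
bounded, so that the absolutely summable theta series is a majorant.
\<close>

section \<open>Convergence of the infinite products\<close>

lemma convergent_prod_one_minus_geometric:
  fixes a p :: complex
  assumes "norm p < 1"
  shows "convergent_prod (\<lambda>n. 1 - a * p ^ n)"
proof -
  have "summable (\<lambda>n. norm a * norm p ^ n)"
    using assms by (intro summable_mult summable_geometric) simp
  then have "summable (\<lambda>n. norm ((1 - a * p ^ n) - 1))"
    by (simp add: norm_mult norm_power)
  then show ?thesis
    by (intro abs_convergent_prod_imp_convergent_prod summable_imp_abs_convergent_prod)
qed

lemma qpoch_tendsto:
  assumes "norm p < 1"
  shows "(\<lambda>n. \<Prod>i<n. 1 - a * p ^ i) \<longlonglongrightarrow> qpoch a p"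
  unfolding qpoch_def
  by (intro has_prod_imp_tendsto' convergent_prod_has_prod convergent_prod_one_minus_geometric assms)

lemma theta_tendsto:
  assumes "norm p < 1"
  shows "(\<lambda>n. \<Prod>i<n. (1 - x * p ^ i) * (1 - p ^ (i + 1) / x)) \<longlonglongrightarrow> theta x p"
proof -
  have "convergent_prod (\<lambda>i. (1 - x * p ^ i) * (1 - p / x * p ^ i))"
    by (intro convergent_prod_mult convergent_prod_one_minus_geometric assms)
  then show ?thesis
    unfolding theta_def by (intro has_prod_imp_tendsto' convergent_prod_has_prod) simp
qed

lemma one_minus_power_nonzero:
  fixes p :: complex
  assumes "norm p < 1"
  shows "1 - p * p ^ n \<noteq> 0"
proof
  assume "1 - p * p ^ n = 0"
  then have "norm p ^ Suc n = 1"
    by (metis eq_iff_diff_eq_0 norm_one norm_power power_Suc)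
  then show False
    using assms power_Suc_less_one[of "norm p" n] by (cases "p = 0") auto
qed

lemma qpoch_self_nonzero:
  assumes "norm p < 1"
  shows "qpoch p p \<noteq> 0"
  unfolding qpoch_def
  by (intro prodinf_nonzero convergent_prod_one_minus_geometric one_minus_power_nonzero assms)

text \<open>Factorwise this is \<open>1 - p\<^sup>2\<^sup>k = (1 - p\<^sup>k) (1 + p\<^sup>k)\<close>. It turns the normalisation of theta series
of nome \<open>p\<^sup>2\<close> into that of nome \<open>p\<close>.\<close>

lemma qpoch_square:
  assumes "norm p < 1"
  shows "qpoch (p ^ 2) (p ^ 2) = qpoch p p * qpoch (- p) p"
proof -
  have "qpoch p p * qpoch (- p) p = (\<Prod>n. (1 - p * p ^ n) * (1 - - p * p ^ n))"
    unfolding qpoch_def by (intro prodinf_mult convergent_prod_one_minus_geometric assms)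
  also have "\<dots> = qpoch (p ^ 2) (p ^ 2)"
    unfolding qpoch_def
    by (intro prodinf_cong) (simp add: algebra_simps power2_eq_square power_mult_distrib)
  finally show ?thesis ..
qed

section \<open>Unordered sums\<close>

text \<open>An unordered sum is an integral against counting measure, so this is Lebesgue's dominated
convergence theorem.\<close>

lemma has_sum_dominated_limit:
  fixes s :: "nat \<Rightarrow> 'a \<Rightarrow> complex"
  assumes sums: "\<And>n. (s n has_sum S n) UNIV"
    and lim: "\<And>j. (\<lambda>n. s n j) \<longlonglongrightarrow> t j"
    and bound: "\<And>n j. norm (s n j) \<le> w j"
    and w: "w summable_on UNIV"
    and S: "S \<longlonglongrightarrow> L"
  shows "(t has_sum L) UNIV"
proof -
  have w0: "0 \<le> w j" for j
    using bound norm_ge_zero order_trans by blast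
  have "Infinite_Sum.abs_summable_on w UNIV"
    using w w0 by simp
  then have wint: "integrable (count_space UNIV) w"
    using abs_summable_equivalent[of w UNIV] by (simp add: Infinite_Set_Sum.abs_summable_on_def)
  have sabs: "Infinite_Sum.abs_summable_on (s n) UNIV" for n
    by (rule summable_on_comparison_test[OF w]) (auto simp: bound)
  have "norm (t j) \<le> w j" for j
    by (rule Lim_bounded[OF tendsto_norm[OF lim]]) (use bound in auto)
  then have tabs: "Infinite_Sum.abs_summable_on t UNIV"
    by (intro summable_on_comparison_test[OF w]) auto
  have S_eq: "integral\<^sup>L (count_space UNIV) (s n) = S n" for n
    using infsetsum_infsum[of "s n" UNIV] abs_summable_equivalent[of "s n" UNIV] sabs[of n]
      infsumI[OF sums[of n]]
    by (simp add: infsetsum_def)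
  have t_eq: "integral\<^sup>L (count_space UNIV) t = infsum t UNIV"
    using infsetsum_infsum[of t UNIV] abs_summable_equivalent[of t UNIV] tabs
    by (simp add: infsetsum_def)
  have "(\<lambda>n. integral\<^sup>L (count_space UNIV) (s n)) \<longlonglongrightarrow> integral\<^sup>L (count_space UNIV) t"
    by (rule integral_dominated_convergence[where w = w]) (auto simp: wint lim bound AE_count_space)
  then have "infsum t UNIV = L"
    unfolding S_eq t_eq using S LIMSEQ_unique by blast
  then show ?thesis
    using has_sum_infsum[OF abs_summable_summable[OF tabs]] by simp
qed

text \<open>Absolute summability makes the double series summable in some value; summing it row by row
identifies that value.\<close>

lemma has_sum_pair_product:
  fixes f g :: "'a :: countable \<Rightarrow> complex"
  assumes f: "(f has_sum F) UNIV" and g: "(g has_sum G) UNIV"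
    and "Infinite_Sum.abs_summable_on f UNIV" "Infinite_Sum.abs_summable_on g UNIV"
  shows "((\<lambda>(m, n). f m * g n) has_sum F * G) UNIV"
proof -
  have "Infinite_Set_Sum.abs_summable_on (\<lambda>(m, n). f m * g n) (UNIV \<times> UNIV)"
    using assms(3,4) unfolding abs_summable_equivalent by (intro abs_summable_on_product) auto
  then have "(\<lambda>(m, n). f m * g n) summable_on (UNIV \<times> UNIV)"
    using abs_summable_equivalent abs_summable_summable by blast
  then obtain S where S: "((\<lambda>(m, n). f m * g n) has_sum S) (UNIV \<times> UNIV)"
    by (auto simp: summable_on_def)
  have "((\<lambda>m. f m * G) has_sum S) UNIV"
    by (rule has_sum_SigmaD[OF S]) (auto intro: has_sum_cmult_right[OF g])
  moreover have "((\<lambda>m. f m * G) has_sum F * G) UNIV"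
    by (rule has_sum_cmult_left[OF f])
  ultimately have "S = F * G"
    by (rule has_sum_unique)
  with S show ?thesis by simp
qed

section \<open>The Jacobi triple product\<close>

text \<open>Integer powers give a bilateral series. The exponent \<open>j (j - 1) div 2\<close> is an exact division,
since one of the two factors is even.\<close>

definition theta_term :: "complex \<Rightarrow> complex \<Rightarrow> int \<Rightarrow> complex" where
  "theta_term p x j = (- 1) powi j * p powi (j * (j - 1) div 2) * x powi j"

lemma triangle_Suc: "(j + 1) * (j + 1 - 1) div 2 = j * (j - 1) div 2 + (j :: int)"
proof -
  have "(j + 1) * (j + 1 - 1) = j * (j - 1) + 2 * j"
    by (simp add: algebra_simps)
  then show ?thesis by simp
qed

lemma theta_term_Suc:
  assumes "p \<noteq> 0" "x \<noteq> 0"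
  shows "theta_term p x (j + 1) = - x * p powi j * theta_term p x j"
  unfolding theta_term_def triangle_Suc using assms by (simp add: power_int_add)

lemma theta_term_pred:
  assumes "p \<noteq> 0" "x \<noteq> 0"
  shows "x * theta_term p x (j - 1) = - (p powi (1 - j)) * theta_term p x j"
  using theta_term_Suc[OF assms, of "j - 1"] assms
  by (simp add: power_int_diff field_simps)

text \<open>The exponent \<open>j (j - 1) / 2\<close> is invariant under \<open>j \<mapsto> 1 - j\<close>; this symmetry reduces the summability
at \<open>-\<infinity>\<close> to that at \<open>\<infinity>\<close>.\<close>

lemma theta_term_reflect:
  assumes "p \<noteq> 0" "x \<noteq> 0"
  shows "theta_term p x (1 - j) = - x * theta_term p (1 / x) j"
proof -
  have "(1 - j) * (1 - j - 1) = j * (j - 1)"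
    by (simp add: algebra_simps)
  then show ?thesis
    unfolding theta_term_def using assms
    by (simp add: power_int_diff power_int_divide_distrib power_int_minus_left field_simps)
qed

text \<open>Consecutive terms have ratio \<open>- x p\<^sup>j\<close>, which tends to zero.\<close>

lemma theta_term_abs_summable_nonneg:
  assumes p: "p \<noteq> 0" "norm p < 1" and x: "x \<noteq> 0"
  shows "Infinite_Sum.abs_summable_on (theta_term p x) {0..}"
proof -
  have "(\<lambda>n. norm (x * p ^ n)) \<longlonglongrightarrow> 0"
    using p by (intro tendsto_norm_zero tendsto_mult_right_zero LIMSEQ_power_zero)
  then have "\<forall>\<^sub>F n in sequentially. norm (x * p ^ n) < 1 / 2"
    by (rule order_tendstoD) simp
  then obtain M where M: "\<And>n. n \<ge> M \<Longrightarrow> norm (x * p ^ n) \<le> 1 / 2"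
    unfolding eventually_sequentially using less_imp_le by blast
  have "summable (\<lambda>n. norm (theta_term p x (int n)))"
  proof (rule summable_ratio_test[where c = "1 / 2" and N = M])
    fix n assume "n \<ge> M"
    have "norm (theta_term p x (int (Suc n))) = norm (x * p ^ n) * norm (theta_term p x (int n))"
      using theta_term_Suc[OF p(1) x, of "int n"] by (simp add: norm_mult add.commute)
    also have "\<dots> \<le> 1 / 2 * norm (theta_term p x (int n))"
      using M[OF \<open>n \<ge> M\<close>] by (intro mult_right_mono) auto
    finally show "norm (norm (theta_term p x (int (Suc n)))) \<le> 1 / 2 * norm (norm (theta_term p x (int n)))"
      by simp
  qed simp
  then have "(\<lambda>n. norm (theta_term p x (int n))) summable_on UNIV"
    by (intro norm_summable_imp_summable_on) simp
  moreover have "bij_betw int UNIV {0..}"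
    by (intro bij_betwI[where g = nat]) auto
  ultimately show ?thesis
    using summable_on_reindex_bij_betw[of int UNIV "{0..}" "\<lambda>j. norm (theta_term p x j)"] by simp
qed

lemma theta_term_abs_summable:
  assumes p: "p \<noteq> 0" "norm p < 1" and x: "x \<noteq> 0"
  shows "Infinite_Sum.abs_summable_on (theta_term p x) UNIV"
proof -
  have "(\<lambda>j. norm x * norm (theta_term p (1 / x) j)) summable_on {0..}"
    using theta_term_abs_summable_nonneg[OF p, of "1 / x"] x by (intro summable_on_cmult_right) auto
  then have "(\<lambda>j. norm (theta_term p x (1 - j))) summable_on {0..}"
    by (simp add: theta_term_reflect[OF p(1) x] norm_mult)
  moreover have "bij_betw (\<lambda>j::int. 1 - j) {0..} {..1}"
    by (intro bij_betwI[where g = "\<lambda>j. 1 - j"]) auto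
  ultimately have "Infinite_Sum.abs_summable_on (theta_term p x) {..1}"
    using summable_on_reindex_bij_betw[of "\<lambda>j. 1 - j" "{0..}" "{..1}" "\<lambda>j. norm (theta_term p x j)"]
    by simp
  then have "Infinite_Sum.abs_summable_on (theta_term p x) {..-1}"
    by (rule summable_on_subset_banach) auto
  from summable_on_Un_disjoint[OF this theta_term_abs_summable_nonneg[OF p x]]
  have "Infinite_Sum.abs_summable_on (theta_term p x) ({..-1} \<union> {0..})"
    by (auto simp: disjoint_iff)
  moreover have "{..-1} \<union> {0..} = (UNIV :: int set)" by auto
  ultimately show ?thesis by simp
qed

definition qfact :: "complex \<Rightarrow> nat \<Rightarrow> complex" where
  "qfact p n = (\<Prod>i<n. 1 - p * p ^ i)"

text \<open>Extending \<open>1 / (p; p)\<^sub>k\<close> by zero to negative \<open>k\<close> preserves its recurrence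
(\<open>inv_qfact_pred\<close>): at \<open>k = 0\<close> the factor \<open>1 - p\<^sup>0\<close> vanishes. Hence finite sums of \<open>q\<close>-binomials can
be treated as sums over all integers, without boundary terms.\<close>

definition inv_qfact :: "complex \<Rightarrow> int \<Rightarrow> complex" where
  "inv_qfact p k = (if k < 0 then 0 else inverse (qfact p (nat k)))"

text \<open>This is the Gaussian binomial coefficient \<open>2n\<close> over \<open>n + j\<close>, zero for \<open>\<bar>j\<bar> > n\<close>.\<close>

definition central_qbinomial :: "complex \<Rightarrow> nat \<Rightarrow> int \<Rightarrow> complex" where
  "central_qbinomial p n j = qfact p (2 * n) * inv_qfact p (int n + j) * inv_qfact p (int n - j)"

lemma qfact_nonzero:
  assumes "norm p < 1"
  shows "qfact p n \<noteq> 0"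
  using one_minus_power_nonzero[OF assms] by (simp add: qfact_def)

lemma inv_qfact_pred:
  assumes "norm p < 1"
  shows "inv_qfact p (k - 1) = (1 - p powi k) * inv_qfact p k"
proof (cases "k \<le> 0")
  case True
  then show ?thesis by (auto simp: inv_qfact_def)
next
  case False
  then obtain m where m: "k = int (Suc m)"
    by (metis not_less zero_less_imp_eq_int Suc_pred of_nat_0_less_iff not_le)
  have "1 - p * p ^ m \<noteq> 0"
    using qfact_nonzero[OF assms, of "Suc m"] by (simp add: qfact_def)
  then show ?thesis
    unfolding m using qfact_nonzero[OF assms, of m]
    by (simp add: inv_qfact_def qfact_def nat_add_distrib field_simps power_int_add)
qed

text \<open>Two steps of the \<open>q\<close>-Pascal rule at once. Up to \<open>qfact p (2 * n)\<close>, every coefficient on the right is a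
polynomial in \<open>u\<close>, \<open>v\<close> and \<open>1 / p\<close> times \<open>R S\<close>, where \<open>R\<close> and \<open>S\<close> are the inverse factorials of the left-hand side. In terms of
\<open>u = p\<^bsup>n+1+j\<^esup>\<close> and \<open>v = p\<^bsup>n+1-j\<^esup>\<close> the claim becomes the polynomial identity
\<open>(1 - uv) (1 - uv/p) = (1 + uv/p) (1 - u) (1 - v) + v (1 - u) (1 - u/p) + u (1 - v) (1 - v/p)\<close>.\<close>

lemma central_qbinomial_Suc:
  assumes p: "p \<noteq> 0" "norm p < 1"
  shows "central_qbinomial p (Suc n) j =
    (1 + p ^ (2 * n + 1)) * central_qbinomial p n j
    + p ^ n * p powi (1 - j) * central_qbinomial p n (j - 1)
    + p ^ (n + 1) * p powi j * central_qbinomial p n (j + 1)"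
proof -
  define u where "u = p powi (int n + 1 + j)"
  define v where "v = p powi (int n + 1 - j)"
  define R where "R = inv_qfact p (int n + 1 + j)"
  define S where "S = inv_qfact p (int n + 1 - j)"
  have R1: "inv_qfact p (int n + j) = (1 - u) * R"
    using inv_qfact_pred[OF p(2), of "int n + 1 + j"] by (simp add: u_def R_def)
  have R2: "inv_qfact p (int n + (j - 1)) = (1 - u / p) * ((1 - u) * R)"
    using inv_qfact_pred[OF p(2), of "int n + j"] p(1)
    by (simp add: R1 u_def power_int_add add_diff_eq)
  have S1: "inv_qfact p (int n - j) = (1 - v) * S"
    using inv_qfact_pred[OF p(2), of "int n + 1 - j"] by (simp add: v_def S_def)
  have S2: "inv_qfact p (int n - (j + 1)) = (1 - v / p) * ((1 - v) * S)"
    using inv_qfact_pred[OF p(2), of "int n - j"] p(1)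
    by (simp add: S1 v_def power_int_add power_int_diff diff_diff_eq)
  have "u * v = p powi int (2 * n + 2)"
    unfolding u_def v_def using p(1) by (subst power_int_add[symmetric]) (auto simp: algebra_simps)
  then have uv: "u * v = p ^ (2 * n + 2)"
    by (simp only: power_int_of_nat)
  have q2: "p ^ (2 * n + 1) = u * v / p"
    using p(1) by (simp add: uv)
  have Q: "qfact p (2 * Suc n) = (1 - u * v / p) * (1 - u * v) * qfact p (2 * n)"
    by (simp add: qfact_def uv q2[symmetric] mult_ac)
  have v': "p ^ n * p powi (1 - j) = v"
    using p(1) by (simp add: v_def power_int_add power_int_diff)
  have u': "p ^ (n + 1) * p powi j = u"
    using p(1) by (simp add: u_def power_int_add)
  have eqs: "int (Suc n) + j = int n + 1 + j" "int (Suc n) - j = int n + 1 - j"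
    "int n + (j + 1) = int n + 1 + j" "int n - (j - 1) = int n + 1 - j" by auto
  show ?thesis
    unfolding central_qbinomial_def eqs Q q2 u' v' R1 R2 S1 S2 R_def[symmetric] S_def[symmetric]
    using p(1) by (simp add: field_simps)
qed

text \<open>Multiplying by the next two factors \<open>(1 - x p\<^sup>n) (1 - p\<^bsup>n+1\<^esup> / x)\<close> combines the series with its shifts by
one in both directions, which is the recurrence \<open>central_qbinomial_Suc\<close>.\<close>

lemma finite_triple_product:
  assumes p: "p \<noteq> 0" "norm p < 1" and x: "x \<noteq> 0"
  shows "((\<lambda>j. central_qbinomial p n j * theta_term p x j)
    has_sum (\<Prod>i<n. (1 - x * p ^ i) * (1 - p ^ (i + 1) / x))) UNIV"
proof (induction n)
  case 0
  have "central_qbinomial p 0 j * theta_term p x j = 0" if "j \<noteq> 0" for j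
    using that by (auto simp: central_qbinomial_def inv_qfact_def)
  moreover have "central_qbinomial p 0 0 * theta_term p x 0 = 1"
    by (simp add: central_qbinomial_def inv_qfact_def qfact_def theta_term_def)
  ultimately show ?case
    by (intro has_sum_finite_neutralI[where B = "{0}"]) auto
next
  case (Suc n)
  define F where "F = (\<Prod>i<n. (1 - x * p ^ i) * (1 - p ^ (i + 1) / x))"
  define a where "a j = central_qbinomial p n j * theta_term p x j" for j
  have a: "(a has_sum F) UNIV"
    using Suc unfolding a_def F_def .
  have down: "((\<lambda>j. a (j - 1)) has_sum F) UNIV"
    using a by (subst has_sum_reindex_bij_witness[where i = "\<lambda>j. j + 1" and j = "\<lambda>j. j - 1" and T = UNIV and h = a]) auto
  have up: "((\<lambda>j. a (j + 1)) has_sum F) UNIV"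
    using a by (subst has_sum_reindex_bij_witness[where i = "\<lambda>j. j - 1" and j = "\<lambda>j. j + 1" and T = UNIV and h = a]) auto
  have "((\<lambda>j. (1 + p ^ (2 * n + 1)) * a j + (- (p ^ n * x)) * a (j - 1) + (- (p ^ (n + 1) / x)) * a (j + 1))
      has_sum ((1 + p ^ (2 * n + 1)) * F + (- (p ^ n * x)) * F + (- (p ^ (n + 1) / x)) * F)) UNIV"
    by (intro has_sum_add has_sum_cmult_right a down up)
  also have "(1 + p ^ (2 * n + 1)) * F + (- (p ^ n * x)) * F + (- (p ^ (n + 1) / x)) * F
      = F * ((1 - x * p ^ n) * (1 - p ^ (n + 1) / x))"
    using x by (simp add: field_simps power_add mult_2 mult_2_right)
  also have "\<dots> = (\<Prod>i<Suc n. (1 - x * p ^ i) * (1 - p ^ (i + 1) / x))"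
    by (simp add: F_def)
  also have "(\<lambda>j. (1 + p ^ (2 * n + 1)) * a j + (- (p ^ n * x)) * a (j - 1) + (- (p ^ (n + 1) / x)) * a (j + 1))
      = (\<lambda>j. central_qbinomial p (Suc n) j * theta_term p x j)"
  proof
    fix j
    have "(- (p ^ n * x)) * a (j - 1) = - (p ^ n) * central_qbinomial p n (j - 1) * (x * theta_term p x (j - 1))"
      by (simp add: a_def)
    also have "\<dots> = p ^ n * p powi (1 - j) * central_qbinomial p n (j - 1) * theta_term p x j"
      unfolding theta_term_pred[OF p(1) x] by simp
    finally have 1: "(- (p ^ n * x)) * a (j - 1) = \<dots>" .
    have 2: "(- (p ^ (n + 1) / x)) * a (j + 1)
        = p ^ (n + 1) * p powi j * central_qbinomial p n (j + 1) * theta_term p x j"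
      unfolding a_def theta_term_Suc[OF p(1) x] using x by simp
    show "(1 + p ^ (2 * n + 1)) * a j + (- (p ^ n * x)) * a (j - 1) + (- (p ^ (n + 1) / x)) * a (j + 1)
        = central_qbinomial p (Suc n) j * theta_term p x j"
      unfolding 1 2 unfolding central_qbinomial_Suc[OF p] a_def by (simp only: distrib_right mult.assoc)
  qed
  finally show ?case .
qed

lemma qfact_tendsto:
  assumes "norm p < 1"
  shows "qfact p \<longlonglongrightarrow> qpoch p p"
  using qpoch_tendsto[OF assms, of p] by (simp add: qfact_def[abs_def])

lemma inv_qfact_tendsto:
  assumes "norm p < 1"
  shows "(\<lambda>n. inv_qfact p (int n + j)) \<longlonglongrightarrow> inverse (qpoch p p)"
proof -
  have "filterlim (\<lambda>n. nat (int n + j)) at_top sequentially"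
    unfolding filterlim_at_top eventually_sequentially
  proof
    fix Z
    show "\<exists>M. \<forall>n\<ge>M. Z \<le> nat (int n + j)"
      by (intro exI[of _ "nat (int Z - j)"]) auto
  qed
  then have "(\<lambda>n. inverse (qfact p (nat (int n + j)))) \<longlonglongrightarrow> inverse (qpoch p p)"
    by (intro tendsto_inverse filterlim_compose[OF qfact_tendsto] qpoch_self_nonzero assms)
  moreover have "\<forall>\<^sub>F n in sequentially. inverse (qfact p (nat (int n + j))) = inv_qfact p (int n + j)"
    using eventually_ge_at_top[of "nat (- j)"] by eventually_elim (auto simp: inv_qfact_def)
  ultimately show ?thesis
    by (rule Lim_transform_eventually)
qed

lemma inv_qfact_bounded:
  assumes "norm p < 1"
  obtains B where "\<And>k. norm (inv_qfact p k) \<le> B"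
proof -
  have "Bseq (\<lambda>n. inv_qfact p (int n + 0))"
    by (rule convergent_imp_Bseq[OF convergentI[OF inv_qfact_tendsto[OF assms]]])
  then obtain B where B: "B > 0" "\<And>n. norm (inv_qfact p (int n)) \<le> B"
    by (auto simp: Bseq_def)
  have "norm (inv_qfact p k) \<le> B" for k
    using B(1) B(2)[of "nat k"] by (cases "k < 0") (auto simp: inv_qfact_def)
  then show ?thesis by (rule that)
qed

text \<open>As \<open>n\<close> grows, the central \<open>q\<close>-binomials tend to \<open>1 / (p; p)\<^sub>\<infinity>\<close> for each fixed \<open>j\<close>, and they are
bounded uniformly in \<open>n\<close> and \<open>j\<close>. So the finite identity passes to the limit term by term.\<close>

lemma jacobi_triple_product:
  assumes p: "p \<noteq> 0" "norm p < 1" and x: "x \<noteq> 0"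
  shows "(theta_term p x has_sum (qpoch p p * theta x p)) UNIV"
proof -
  define q where "q = qpoch p p"
  have q: "q \<noteq> 0" unfolding q_def by (rule qpoch_self_nonzero[OF p(2)])
  obtain B where B: "\<And>k. norm (inv_qfact p k) \<le> B"
    using inv_qfact_bounded[OF p(2)] by blast
  have B0: "0 \<le> B" using B norm_ge_zero order_trans by blast
  obtain A where A: "\<And>n. norm (qfact p n) \<le> A"
    using convergent_imp_Bseq[OF convergentI[OF qfact_tendsto[OF p(2)]]] by (auto simp: Bseq_def)
  have A0: "0 \<le> A" using A norm_ge_zero order_trans by blast
  have "(\<lambda>n. qfact p (2 * n)) \<longlonglongrightarrow> q"
    unfolding q_def by (rule LIMSEQ_subseq_LIMSEQ[OF qfact_tendsto[OF p(2)], unfolded o_def])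
      (simp add: strict_mono_def)
  then have "(\<lambda>n. central_qbinomial p n j) \<longlonglongrightarrow> q * inverse q * inverse q" for j
    unfolding central_qbinomial_def diff_conv_add_uminus q_def
    by (intro tendsto_mult inv_qfact_tendsto p(2))
  then have lim: "(\<lambda>n. central_qbinomial p n j * theta_term p x j) \<longlonglongrightarrow> inverse q * theta_term p x j" for j
    using q by (intro tendsto_mult_right) simp
  have bound: "norm (central_qbinomial p n j * theta_term p x j) \<le> (A * B * B) * norm (theta_term p x j)" for n j
    unfolding norm_mult central_qbinomial_def
    by (intro mult_right_mono mult_mono A B mult_nonneg_nonneg A0 B0 norm_ge_zero)
  have "((\<lambda>j. inverse q * theta_term p x j) has_sum theta x p) UNIV"
    by (rule has_sum_dominated_limit[OF finite_triple_product[OF p x] lim bound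
          summable_on_cmult_right[OF theta_term_abs_summable[OF p x]] theta_tendsto[OF p(2)]])
  from has_sum_cmult_right[OF this, of q] show ?thesis
    using q by (simp add: q_def mult.assoc[symmetric])
qed

section \<open>The addition formula\<close>

lemma double_triangle: "2 * (j * (j - 1) div 2) = j * (j - 1 :: int)"
  by (rule dvd_mult_div_cancel) (cases "even j"; simp)

lemma theta_term_square_minus_square:
  assumes "p \<noteq> 0" "a \<noteq> 0"
  shows "theta_term (p ^ 2) (- (a ^ 2)) s = p powi (s * (s - 1)) * a powi (2 * s)"
proof -
  have "(p ^ 2) powi (s * (s - 1) div 2) = p powi (2 * (s * (s - 1) div 2))"
    by (simp only: power_int_mult power_int_numeral)
  then have "(p ^ 2) powi (s * (s - 1) div 2) = p powi (s * (s - 1))"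
    unfolding double_triangle .
  moreover have "(- (a ^ 2)) powi s = (- 1) powi s * a powi (2 * s)"
    using power_int_mult_distrib[of "- 1" "a ^ 2" s] by (simp add: power_int_mult)
  ultimately show ?thesis
    unfolding theta_term_def by (simp add: power_int_mult_distrib[symmetric])
qed

lemma theta_term_square_minus_mult_square:
  assumes "p \<noteq> 0" "a \<noteq> 0"
  shows "theta_term (p ^ 2) (- p * a ^ 2) s = p powi (s * s) * a powi (2 * s)"
proof -
  have "theta_term (p ^ 2) (- p * a ^ 2) s = theta_term (p ^ 2) (- (a ^ 2)) s * p powi s"
    using power_int_mult_distrib[of "- (a ^ 2)" p s] unfolding theta_term_def by (simp add: mult.commute)
  also have "\<dots> = p powi (s * (s - 1) + s) * a powi (2 * s)"
    unfolding theta_term_square_minus_square[OF assms] using assms by (simp add: power_int_add)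
  also have "s * (s - 1) + s = s * s"
    by (simp add: algebra_simps)
  finally show ?thesis .
qed

lemma theta_term_mult:
  assumes "p \<noteq> 0" "x \<noteq> 0" "y \<noteq> 0"
  shows "theta_term p (y * x) m * theta_term p (y / x) n =
    (- 1) powi (m + n) * p powi (m * (m - 1) div 2 + n * (n - 1) div 2) * y powi (m + n) * x powi (m - n)"
  unfolding theta_term_def using assms
  by (simp add: power_int_add power_int_diff power_int_mult_distrib power_int_divide_distrib)

text \<open>With \<open>m = s + t\<close> and \<open>n = s - t\<close> the sign is \<open>1\<close>, and the exponent of \<open>p\<close> separates:
\<open>m (m - 1) / 2 + n (n - 1) / 2 = s (s - 1) + t\<^sup>2\<close>.\<close>

lemma theta_term_mult_even:
  assumes "p \<noteq> 0" "x \<noteq> 0" "y \<noteq> 0"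
  shows "theta_term p (y * x) (s + t) * theta_term p (y / x) (s - t) =
    theta_term (p ^ 2) (- (y ^ 2)) s * theta_term (p ^ 2) (- p * x ^ 2) t"
proof -
  have "2 * ((s + t) * (s + t - 1) div 2 + (s - t) * (s - t - 1) div 2) = 2 * (s * (s - 1) + t * t)"
    unfolding distrib_left double_triangle by (simp add: algebra_simps)
  then have e: "(s + t) * (s + t - 1) div 2 + (s - t) * (s - t - 1) div 2 = s * (s - 1) + t * t"
    by simp
  have "s + t + (s - t) = 2 * s" "s + t - (s - t) = 2 * t" by auto
  then show ?thesis
    unfolding theta_term_mult[OF assms] e theta_term_square_minus_square[OF assms(1,3)]
      theta_term_square_minus_mult_square[OF assms(1,2)]
    using assms by (simp add: power_int_add power_int_mult)
qed

text \<open>With \<open>m = s + t\<close> and \<open>n = s - t + 1\<close> the sign is \<open>- 1\<close>, and the exponent of \<open>p\<close> separates with the roles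
of \<open>s\<close> and \<open>t\<close> exchanged: \<open>m (m - 1) / 2 + n (n - 1) / 2 = s\<^sup>2 + t (t - 1)\<close>.\<close>

lemma theta_term_mult_odd:
  assumes "p \<noteq> 0" "x \<noteq> 0" "y \<noteq> 0"
  shows "theta_term p (y * x) (s + t) * theta_term p (y / x) (s - t + 1) =
    - (y / x) * (theta_term (p ^ 2) (- p * y ^ 2) s * theta_term (p ^ 2) (- (x ^ 2)) t)"
proof -
  have "2 * ((s + t) * (s + t - 1) div 2 + (s - t + 1) * (s - t + 1 - 1) div 2) = 2 * (s * s + t * (t - 1))"
    unfolding distrib_left double_triangle by (simp add: algebra_simps)
  then have e: "(s + t) * (s + t - 1) div 2 + (s - t + 1) * (s - t + 1 - 1) div 2 = s * s + t * (t - 1)"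
    by simp
  have m: "s + t + (s - t + 1) = 2 * s + 1" "s + t - (s - t + 1) = 2 * t - 1" by auto
  have sign: "(- 1 :: complex) powi (2 * s + 1) = - 1"
    by (simp add: power_int_add)
  show ?thesis
    unfolding theta_term_mult[OF assms] e m sign theta_term_square_minus_square[OF assms(1,2)]
      theta_term_square_minus_mult_square[OF assms(1,3)]
    using assms by (simp add: power_int_add power_int_diff power_int_mult mult_ac)
qed

lemma theta_addition_formula_nonzero_nome:
  assumes p: "p \<noteq> 0" "norm p < 1" and x: "x \<noteq> 0" and y: "y \<noteq> 0"
  shows "x * thetas [y * x, y / x] p = P p y * Q p x - P p x * Q p y"
proof -
  define q where "q = qpoch p p"
  define r where "r = qpoch (p ^ 2) (p ^ 2)"
  have q: "q \<noteq> 0" unfolding q_def by (rule qpoch_self_nonzero[OF p(2)])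
  have r: "r = q * qpoch (- p) p" unfolding r_def q_def by (rule qpoch_square[OF p(2)])
  have p2: "p ^ 2 \<noteq> 0" "norm (p ^ 2) < 1"
    using p by (auto simp: norm_power power_less_one_iff)
  note triple = jacobi_triple_product[OF p] jacobi_triple_product[OF p2]
  note abs_summable = theta_term_abs_summable[OF p] theta_term_abs_summable[OF p2]
  let ?g = "\<lambda>(m, n). theta_term p (y * x) m * theta_term p (y / x) n"
  let ?Even = "{(m, n). even (m + n)} :: (int \<times> int) set"
  let ?Odd = "{(m, n). odd (m + n)} :: (int \<times> int) set"
  have total: "(?g has_sum (q * theta (y * x) p) * (q * theta (y / x) p)) UNIV"
    unfolding q_def by (intro has_sum_pair_product triple abs_summable) (use x y in auto)
  have even: "(?g has_sum (r * theta (- (y ^ 2)) (p ^ 2)) * (r * theta (- p * x ^ 2) (p ^ 2))) ?Even"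
  proof -
    have bij: "bij_betw (\<lambda>(s, t). (s + t, s - t)) UNIV ?Even"
      by (intro bij_betwI[where g = "\<lambda>(m, n). ((m + n) div 2, (m - n) div 2)"]) (auto, presburger+)
    have pull: "?g (case z of (s, t) \<Rightarrow> (s + t, s - t)) = (case z of (s, t) \<Rightarrow>
        theta_term (p ^ 2) (- (y ^ 2)) s * theta_term (p ^ 2) (- p * x ^ 2) t)" for z
      by (cases z) (simp only: prod.case theta_term_mult_even[OF p(1) x y])
    have "((\<lambda>(s, t). theta_term (p ^ 2) (- (y ^ 2)) s * theta_term (p ^ 2) (- p * x ^ 2) t)
        has_sum (r * theta (- (y ^ 2)) (p ^ 2)) * (r * theta (- p * x ^ 2) (p ^ 2))) UNIV"
      unfolding r_def by (intro has_sum_pair_product triple abs_summable) (use x y p in auto)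
    then show ?thesis
      unfolding has_sum_reindex_bij_betw[OF bij, of ?g, symmetric] pull .
  qed
  have odd: "(?g has_sum - (y / x) * ((r * theta (- p * y ^ 2) (p ^ 2)) * (r * theta (- (x ^ 2)) (p ^ 2)))) ?Odd"
  proof -
    have bij: "bij_betw (\<lambda>(s, t). (s + t, s - t + 1)) UNIV ?Odd"
      by (intro bij_betwI[where g = "\<lambda>(m, n). ((m + n) div 2, (m - n + 1) div 2)"]) (auto, presburger+)
    have pull: "?g (case z of (s, t) \<Rightarrow> (s + t, s - t + 1)) = - (y / x) * (case z of (s, t) \<Rightarrow>
        theta_term (p ^ 2) (- p * y ^ 2) s * theta_term (p ^ 2) (- (x ^ 2)) t)" for z
      by (cases z) (simp only: prod.case theta_term_mult_odd[OF p(1) x y])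
    have "((\<lambda>(s, t). theta_term (p ^ 2) (- p * y ^ 2) s * theta_term (p ^ 2) (- (x ^ 2)) t)
        has_sum (r * theta (- p * y ^ 2) (p ^ 2)) * (r * theta (- (x ^ 2)) (p ^ 2))) UNIV"
      unfolding r_def by (intro has_sum_pair_product triple abs_summable) (use x y p in auto)
    then show ?thesis
      unfolding has_sum_reindex_bij_betw[OF bij, of ?g, symmetric] pull by (rule has_sum_cmult_right)
  qed
  have "?Even \<inter> ?Odd = {}" "?Even \<union> ?Odd = UNIV" by auto
  with has_sum_Un_disjoint[OF even odd] have
    "(?g has_sum (r * theta (- (y ^ 2)) (p ^ 2)) * (r * theta (- p * x ^ 2) (p ^ 2))
      + - (y / x) * ((r * theta (- p * y ^ 2) (p ^ 2)) * (r * theta (- (x ^ 2)) (p ^ 2)))) UNIV"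
    by simp
  with total have "(q * theta (y * x) p) * (q * theta (y / x) p) =
      (r * theta (- (y ^ 2)) (p ^ 2)) * (r * theta (- p * x ^ 2) (p ^ 2))
      + - (y / x) * ((r * theta (- p * y ^ 2) (p ^ 2)) * (r * theta (- (x ^ 2)) (p ^ 2)))"
    by (rule has_sum_unique)
  then have "q ^ 2 * (x * thetas [y * x, y / x] p) = q ^ 2 * (P p y * Q p x - P p x * Q p y)"
    using x unfolding r thetas_def P_def Q_def by (simp add: field_simps power2_eq_square)
  with q show ?thesis by simp
qed

lemma prodinf_first:
  fixes f :: "nat \<Rightarrow> complex"
  assumes "\<And>n. n > 0 \<Longrightarrow> f n = 1"
  shows "prodinf f = f 0"
  using prodinf_finite[of "{0}" f] assms by simp

text \<open>For \<open>p = 0\<close> the series argument breaks down, since negative powers of \<open>p\<close> occur in it. There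
\<open>\<theta>(z; 0) = 1 - z\<close>, and the formula is the factorisation
\<open>(1 + y\<^sup>2) x - (1 + x\<^sup>2) y = (x - y) (1 - x y)\<close>.\<close>

theorem theta_addition_formula:
  assumes p: "norm p < 1" and x: "x \<noteq> 0" and y: "y \<noteq> 0"
  shows "x * thetas [y * x, y / x] p = P p y * Q p x - P p x * Q p y"
proof (cases "p = 0")
  case True
  have theta0: "theta z 0 = 1 - z" for z
    unfolding theta_def by (subst prodinf_first) auto
  have qpoch0: "qpoch 0 0 = 1"
    unfolding qpoch_def by simp
  have "x * ((1 - y * x) * (1 - y / x)) = (1 + y ^ 2) * x - (1 + x ^ 2) * y"
    using x by (simp add: field_simps power2_eq_square)
  then show ?thesis
    unfolding True P_def Q_def thetas_def by (simp add: theta0 qpoch0)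
next
  case False
  then show ?thesis by (rule theta_addition_formula_nonzero_nome[OF _ p x y])
qed

section \<open>Lagrange interpolation for binary forms\<close>

text \<open>The induction step from degree \<open>N\<close> to \<open>N + 1\<close>: interpolation passes from \<open>A\<close> to its product with a
linear form \<open>L\<close>. In the \<open>k\<close>-th summand of \<open>A\<close>, interpolate \<open>L\<close> between the \<open>k\<close>-th point and the new
one. The part with the value of \<open>L\<close> at the \<open>k\<close>-th point is the \<open>k\<close>-th summand of the new formula. The
parts with its value at the new point have the common factor \<open>\<Prod>i\<le>N. D i s t\<close>, and what remains
is the interpolation formula for \<open>A\<close> evaluated at the new point.\<close>

lemma linear_times_interpolation:
  fixes u v :: "nat \<Rightarrow> 'a :: field" and A :: "'a \<Rightarrow> 'a \<Rightarrow> 'a"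
  defines "D \<equiv> \<lambda>i s t. u i * t - v i * s"
  assumes D: "\<And>i k. i \<le> Suc N \<Longrightarrow> k \<le> Suc N \<Longrightarrow> i \<noteq> k \<Longrightarrow> D i (u k) (v k) \<noteq> 0"
    and A: "\<And>s t. A s t = (\<Sum>k\<le>N. A (u k) (v k) * (\<Prod>i\<in>{..N}-{k}. D i s t / D i (u k) (v k)))"
  shows "(\<alpha> * s + \<beta> * t) * A s t = (\<Sum>k\<le>Suc N. (\<alpha> * u k + \<beta> * v k) * A (u k) (v k) *
    (\<Prod>i\<in>{..Suc N}-{k}. D i s t / D i (u k) (v k)))"
proof -
  let ?L = "\<lambda>s t. \<alpha> * s + \<beta> * t"
  let ?m = "Suc N"
  let ?Dk = "\<lambda>i k. D i (u k) (v k)"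
  have linear: "?L s t = ?L (u k) (v k) * (D ?m s t / ?Dk ?m k)
      + ?L (u ?m) (v ?m) * (D k s t / ?Dk k ?m)" if "k \<le> N" for k
  proof -
    have "?Dk ?m k \<noteq> 0" using D[of ?m k] that by simp
    moreover have "?Dk k ?m = - ?Dk ?m k" by (simp add: D_def)
    ultimately have "?L s t * ?Dk ?m k = ?L (u k) (v k) * D ?m s t - ?L (u ?m) (v ?m) * D k s t
       \<Longrightarrow> ?thesis" by (simp add: divide_simps) 
    moreover have "?L s t * ?Dk ?m k = ?L (u k) (v k) * D ?m s t - ?L (u ?m) (v ?m) * D k s t"
      by (simp add: D_def algebra_simps)
    ultimately show ?thesis by blast
  qed
  have split: "{..?m} - {k} = insert ?m ({..N} - {k})" if "k \<le> N" for k
    using that by auto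
  have last: "{..?m} - {?m} = {..N}" by auto
  have basis_last: "D k s t / ?Dk k ?m * (\<Prod>i\<in>{..N}-{k}. D i s t / ?Dk i k)
      = (\<Prod>i\<le>N. D i s t / ?Dk i ?m) * (\<Prod>i\<in>{..N}-{k}. ?Dk i ?m / ?Dk i k)" if "k \<le> N" for k
  proof -
    have "(\<Prod>i\<le>N. D i s t / ?Dk i ?m)
        = D k s t / ?Dk k ?m * (\<Prod>i\<in>{..N}-{k}. D i s t / ?Dk i ?m)"
      using that by (intro prod.remove) auto
    moreover have "(\<Prod>i\<in>{..N}-{k}. D i s t / ?Dk i ?m) * (\<Prod>i\<in>{..N}-{k}. ?Dk i ?m / ?Dk i k)
        = (\<Prod>i\<in>{..N}-{k}. D i s t / ?Dk i k)"
      unfolding prod.distrib[symmetric] by (rule prod.cong) (use D[of _ ?m] in auto)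
    ultimately show ?thesis by (simp add: mult.assoc)
  qed
  have "?L s t * A s t = (\<Sum>k\<le>N. ?L s t * (A (u k) (v k) * (\<Prod>i\<in>{..N}-{k}. D i s t / ?Dk i k)))"
    by (subst A) (simp add: sum_distrib_left)
  also have "\<dots> = (\<Sum>k\<le>N. ?L (u k) (v k) * A (u k) (v k) * (\<Prod>i\<in>{..?m}-{k}. D i s t / ?Dk i k)
      + ?L (u ?m) (v ?m) * (\<Prod>i\<le>N. D i s t / ?Dk i ?m)
        * (A (u k) (v k) * (\<Prod>i\<in>{..N}-{k}. ?Dk i ?m / ?Dk i k)))"
  proof (rule sum.cong)
    fix k assume "k \<in> {..N}"
    then have k: "k \<le> N" by simp
    have "?L s t * (A (u k) (v k) * (\<Prod>i\<in>{..N}-{k}. D i s t / ?Dk i k))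
      = ?L (u k) (v k) * A (u k) (v k) * (D ?m s t / ?Dk ?m k * (\<Prod>i\<in>{..N}-{k}. D i s t / ?Dk i k))
      + ?L (u ?m) (v ?m) * A (u k) (v k) * (D k s t / ?Dk k ?m * (\<Prod>i\<in>{..N}-{k}. D i s t / ?Dk i k))"
      unfolding linear[OF k] by (simp add: algebra_simps)
    then show "?L s t * (A (u k) (v k) * (\<Prod>i\<in>{..N}-{k}. D i s t / ?Dk i k))
      = ?L (u k) (v k) * A (u k) (v k) * (\<Prod>i\<in>{..?m}-{k}. D i s t / ?Dk i k)
      + ?L (u ?m) (v ?m) * (\<Prod>i\<le>N. D i s t / ?Dk i ?m)
        * (A (u k) (v k) * (\<Prod>i\<in>{..N}-{k}. ?Dk i ?m / ?Dk i k))"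
      unfolding basis_last[OF k] split[OF k] by (simp add: mult_ac)
  qed simp
  also have "\<dots> = (\<Sum>k\<le>N. ?L (u k) (v k) * A (u k) (v k) * (\<Prod>i\<in>{..?m}-{k}. D i s t / ?Dk i k))
      + ?L (u ?m) (v ?m) * (\<Prod>i\<le>N. D i s t / ?Dk i ?m) * A (u ?m) (v ?m)"
    by (subst A[of "u ?m" "v ?m"]) (simp only: sum.distrib sum_distrib_left)
  also have "\<dots> = (\<Sum>k\<le>?m. ?L (u k) (v k) * A (u k) (v k) * (\<Prod>i\<in>{..?m}-{k}. D i s t / ?Dk i k))"
    unfolding sum.atMost_Suc last by (simp only: mult_ac)
  finally show ?thesis .
qed

text \<open>Every form of degree \<open>N + 1\<close> is \<open>t A(s, t) + s B(s, t)\<close> with forms \<open>A\<close> and \<open>B\<close> of degree \<open>N\<close>, so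
the previous lemma applies to both summands. Working with forms rather than with a quotient of
\<open>s\<close> and \<open>t\<close> treats points with \<open>v i = 0\<close> like all others.\<close>

lemma homogeneous_lagrange:
  fixes u v :: "nat \<Rightarrow> 'a :: field" and c :: "nat \<Rightarrow> 'a" and N :: nat
  defines "D \<equiv> \<lambda>i s t. u i * t - v i * s"
    and "H \<equiv> \<lambda>s t. \<Sum>k\<le>N. c k * s ^ k * t ^ (N - k)"
  assumes "\<And>i k. i \<le> N \<Longrightarrow> k \<le> N \<Longrightarrow> i \<noteq> k \<Longrightarrow> D i (u k) (v k) \<noteq> 0"
  shows "H s t = (\<Sum>k\<le>N. H (u k) (v k) * (\<Prod>i\<in>{..N}-{k}. D i s t / D i (u k) (v k)))"
  using assms(3) unfolding H_def
proof (induction N arbitrary: c s t)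
  case 0
  then show ?case by simp
next
  case (Suc N)
  let ?A = "\<lambda>s t. \<Sum>k\<le>N. c k * s ^ k * t ^ (N - k)"
  \<comment> \<open>\<open>?B\<close> is the monomial \<open>c (Suc N) * s ^ N\<close>, written as a form so that the induction hypothesis applies.\<close>
  let ?B = "\<lambda>s t. \<Sum>k\<le>N. (if k = N then c (Suc N) else 0) * s ^ k * t ^ (N - k)"
  have split: "(\<Sum>k\<le>Suc N. c k * s ^ k * t ^ (Suc N - k)) = (0 * s + 1 * t) * ?A s t + (1 * s + 0 * t) * ?B s t" for s t
  proof -
    have "?B s t = (\<Sum>k\<le>N. if k = N then c (Suc N) * s ^ N else 0)"
      by (rule sum.cong) auto
    then have "?B s t = c (Suc N) * s ^ N" by simp
    then show ?thesis by (simp add: sum_distrib_left Suc_diff_le mult_ac)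
  qed
  have D: "u i * v k - v i * u k \<noteq> 0" if "i \<le> Suc N" "k \<le> Suc N" "i \<noteq> k" for i k
    using Suc.prems[OF that] by (simp add: D_def)
  have IH: "(\<Sum>k\<le>N. c k * s ^ k * t ^ (N - k)) = (\<Sum>k\<le>N. (\<Sum>l\<le>N. c l * u k ^ l * v k ^ (N - l)) *
      (\<Prod>i\<in>{..N} - {k}. (u i * t - v i * s) / (u i * v k - v i * u k)))" for c s t
    using Suc.IH[of c s t] Suc.prems unfolding D_def by simp
  have A: "(0 * s + 1 * t) * ?A s t = (\<Sum>k\<le>Suc N. (0 * u k + 1 * v k) * ?A (u k) (v k) *
      (\<Prod>i\<in>{..Suc N} - {k}. D i s t / D i (u k) (v k)))"
    unfolding D_def by (rule linear_times_interpolation[where A = ?A, OF D IH])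
  have B: "(1 * s + 0 * t) * ?B s t = (\<Sum>k\<le>Suc N. (1 * u k + 0 * v k) * ?B (u k) (v k) *
      (\<Prod>i\<in>{..Suc N} - {k}. D i s t / D i (u k) (v k)))"
    unfolding D_def by (rule linear_times_interpolation[where A = ?B, OF D IH])
  show ?case
    unfolding split A B sum.distrib[symmetric] distrib_right[symmetric] by (rule refl)
qed

section \<open>Interpolation of elliptic Askey-Wilson polynomials\<close>

theorem theorem1p11:
  fixes p :: complex and N :: nat and b :: "nat \<Rightarrow> complex"
    and f :: "complex \<Rightarrow> complex" and x :: complex
  assumes "norm p < 1"
    and "\<And>n. b n \<noteq> 0"
    and "\<And>i j. i \<le> N \<Longrightarrow> j \<le> N \<Longrightarrow> i \<noteq> j \<Longrightarrow> b i \<noteq> b j"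
    and "\<And>i k. i \<le> N \<Longrightarrow> k \<le> N \<Longrightarrow> i \<noteq> k \<Longrightarrow> thetas [b i * b k, b i / b k] p \<noteq> 0"
    and "f \<in> elliptic_AW p N"
    and "x \<noteq> 0"
  shows "f x / x ^ N =
    (\<Sum>k=0..N. f (b k) / b k ^ N *
      (\<Prod>i\<in>{0..N} - {k}. thetas [b i * x, b i / x] p / thetas [b i * b k, b i / b k] p))"
proof -
  obtain c where f: "\<And>z. z \<noteq> 0 \<Longrightarrow> f z = (\<Sum>k\<le>N. c k * P p z ^ k * Q p z ^ (N - k))"
    using assms(5) unfolding elliptic_AW_def atLeast0AtMost by auto
  define D where "D i z = P p (b i) * Q p z - Q p (b i) * P p z" for i z
  have D: "D i z = z * thetas [b i * z, b i / z] p" if "z \<noteq> 0" for i z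
    using theta_addition_formula[OF assms(1) that assms(2)[of i]] by (simp add: D_def mult.commute)
  have "D i (b k) \<noteq> 0" if "i \<le> N" "k \<le> N" "i \<noteq> k" for i k
    using assms(4)[OF that] D[OF assms(2)[of k], of i] assms(2)[of k] by simp
  then have "f x = (\<Sum>k\<le>N. f (b k) * (\<Prod>i\<in>{..N} - {k}. D i x / D i (b k)))"
    unfolding f[OF assms(6)] f[OF assms(2)] D_def by (rule homogeneous_lagrange)
  then have "f x / x ^ N = (\<Sum>k\<le>N. f (b k) * (\<Prod>i\<in>{..N} - {k}. D i x / D i (b k)) / x ^ N)"
    by (simp add: sum_divide_distrib)
  also have "\<dots> = (\<Sum>k\<le>N. f (b k) / b k ^ N *
      (\<Prod>i\<in>{..N} - {k}. thetas [b i * x, b i / x] p / thetas [b i * b k, b i / b k] p))"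
  proof (rule sum.cong)
    fix k assume "k \<in> {..N}"
    then have card: "card ({..N} - {k}) = N" by simp
    let ?T = "\<lambda>i. thetas [b i * x, b i / x] p / thetas [b i * b k, b i / b k] p"
    have "(\<Prod>i\<in>{..N} - {k}. D i x / D i (b k)) = (\<Prod>i\<in>{..N} - {k}. x / b k * ?T i)"
      unfolding D[OF assms(6)] D[OF assms(2)] by (simp only: times_divide_times_eq)
    also have "\<dots> = (x / b k) ^ N * (\<Prod>i\<in>{..N} - {k}. ?T i)"
      unfolding prod.distrib prod_constant card ..
    finally show "f (b k) * (\<Prod>i\<in>{..N} - {k}. D i x / D i (b k)) / x ^ N
        = f (b k) / b k ^ N * (\<Prod>i\<in>{..N} - {k}. ?T i)"
      using assms(6) by (simp add: power_divide)
  qed simp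
  finally show ?thesis
    unfolding atLeast0AtMost .
qed

end
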